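(* Let $\mathcal{A}\subseteq\mathbb{R}^d$ be nonempty, compact, and convex, let $\mathcal{L}\subseteq\mathbb{R}^m$ be a set of leader signals, and fix a state $x$. Let $\mu>0$ and $L_{a\ell}\ge 0$. Suppose that for every $\ell\in\mathcal{L}$ the function $a\mapsto U_F(x,\ell,a)\in\mathbb{R}$ is differentiable and $\mu$-strongly concave on $\mathcal{A}$, and that for all $\ell,\ell'\in\mathcal{L}$ and all $a\in\mathcal{A}$, $$\|\nabla_a U_F(x,\ell,a)-\nabla_a U_F(x,\ell',a)\|\le L_{a\ell}\,\|\ell-\ell'\|.$$ Then for every $\ell\in\mathcal{L}$ the follower best response is unique, i.e. $\arg\max_{a\in\mathcal{A}}U_F(x,\ell,a)$ consists of exactly one point $a^\star(x,\ell)$, and for all $\ell,\ell'\in\mathcal{L}$, $$\|a^\star(x,\ell)-a^\star(x,\ell')\|\le\frac{L_{a\ell}}{\mu}\,\|\ell-\ell'\|.$$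
   Context: $U_F(x,\ell,a)$ is the follower's utility at state $x$, leader signal $\ell$ and follower action $a$. Norms are Euclidean. The gradient $\nabla_a$ is with respect to the action $a$; for differentiability at points of $\mathcal{A}$, $U_F(x,\ell,\cdot)$ is understood to be defined on an open set containing $\mathcal{A}$ and differentiable at every point of $\mathcal{A}$. A function $f$ is $\mu$-strongly concave on the convex set $\mathcal{A}$ if $a\mapsto f(a)+\frac{\mu}{2}\|a\|^2$ is concave on $\mathcal{A}$. *)

theory Defs
  imports "HOL-Analysis.Analysis"
begin

(* Unspecified where f is not differentiable. As the derivative is taken over full
   neighbourhoods, only the values of f near a matter, so a function given on an open set
   is represented by any total extension of it. *)
definition gradient :: "('a::real_inner \<Rightarrow> real) \<Rightarrow> 'a \<Rightarrow> 'a"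
  where "gradient f a = (THE D. GDERIV f a :> D)"

definition strongly_concave_on :: "real \<Rightarrow> 'a::real_inner set \<Rightarrow> ('a \<Rightarrow> real) \<Rightarrow> bool"
  where "strongly_concave_on \<mu> S f \<longleftrightarrow> concave_on S (\<lambda>a. f a + \<mu> / 2 * (norm a)\<^sup>2)"

definition argmax_set :: "'a set \<Rightarrow> ('a \<Rightarrow> real) \<Rightarrow> 'a set"
  where "argmax_set S f = {a. is_arg_max f (\<lambda>b. b \<in> S) a}"

(* Meaningful only when the set of maximizers is a singleton. *)
definition best_response ::
  "('x \<Rightarrow> 'l \<Rightarrow> 'a \<Rightarrow> real) \<Rightarrow> 'a set \<Rightarrow> 'x \<Rightarrow> 'l \<Rightarrow> 'a"
  where "best_response U A x l = the_elem (argmax_set A (U x l))"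

end

theory Submission
  imports Defs
begin

text \<open>
  A differentiable \<open>\<mu>\<close>-strongly concave \<open>f\<close> satisfies
  \<open>f b - f a + \<mu>/2 \<parallel>b - a\<parallel>\<^sup>2 \<le> \<langle>\<nabla>f a, b - a\<rangle>\<close>, hence
  \<open>\<mu> \<parallel>b - a\<parallel>\<^sup>2 \<le> \<langle>\<nabla>f a - \<nabla>f b, b - a\<rangle>\<close>; at a maximizer \<open>a\<close> moreover
  \<open>\<langle>\<nabla>f a, b - a\<rangle> \<le> 0\<close> for all feasible \<open>b\<close>. The first and last inequality give
  uniqueness. If \<open>a\<close> maximizes \<open>f\<close> and \<open>b\<close> maximizes \<open>g\<close>, then
  \<open>\<mu> \<parallel>b - a\<parallel>\<^sup>2 \<le> \<langle>\<nabla>f a - \<nabla>f b, b - a\<rangle> \<le> \<langle>\<nabla>g b - \<nabla>f b, b - a\<rangle>\<close>,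
  and Cauchy--Schwarz gives the Lipschitz bound.
\<close>

text \<open>A linear functional on a Euclidean space is the inner product with a vector, here
  \<open>adjoint f' 1\<close>. Uniqueness of the derivative makes that vector unique, so the
  \<open>THE\<close> in \<open>gradient\<close> is well defined.\<close>

lemma GDERIV_gradient:
  fixes f :: "'a::euclidean_space \<Rightarrow> real"
  assumes "f differentiable (at a)"
  shows "GDERIV f a :> gradient f a"
proof -
  obtain f' where f': "(f has_derivative f') (at a)"
    using assms by (auto simp: differentiable_def)
  then have lin: "linear f'"
    by (rule has_derivative_linear)
  have "f' = (\<lambda>h. h \<bullet> adjoint f' 1)"
    using adjoint_works[OF lin, of _ 1] by auto
  then have D: "GDERIV f a :> adjoint f' 1"
    using f' by (simp add: gderiv_def)
  moreover have "E = adjoint f' 1" if "GDERIV f a :> E" for E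
  proof -
    have "(\<lambda>h. h \<bullet> E) = (\<lambda>h. h \<bullet> adjoint f' 1)"
      using has_derivative_unique[OF that[unfolded gderiv_def] D[unfolded gderiv_def]] .
    then show ?thesis
      by (simp only: fun_eq_iff vector_eq_ldot)
  qed
  ultimately show ?thesis
    unfolding gradient_def by (rule theI)
qed

text \<open>Chain rule along the line through \<open>a\<close> in direction \<open>v\<close>. The
  limit is one-sided because only steps with \<open>0 < t \<le> 1\<close> towards another point of a
  convex set are sure to stay in it.\<close>

lemma GDERIV_directional_tendsto:
  assumes "GDERIV f a :> D"
  shows "((\<lambda>t. (f (a + t *\<^sub>R v) - f a) / t) \<longlongrightarrow> D \<bullet> v) (at_right 0)"
proof -
  have "((\<lambda>t. a + t *\<^sub>R v) has_derivative (\<lambda>t. t *\<^sub>R v)) (at 0)"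
    by (auto intro!: derivative_eq_intros)
  moreover have "(f has_derivative (\<lambda>h. h \<bullet> D)) (at (a + 0 *\<^sub>R v))"
    using assms by (simp add: gderiv_def)
  ultimately have "((\<lambda>t. f (a + t *\<^sub>R v)) has_derivative (\<lambda>t. (t *\<^sub>R v) \<bullet> D)) (at 0)"
    by (rule has_derivative_compose)
  moreover have "(\<lambda>t. (t *\<^sub>R v) \<bullet> D) = (*) (D \<bullet> v)"
    by (auto simp: inner_commute)
  ultimately have "((\<lambda>t. f (a + t *\<^sub>R v)) has_real_derivative D \<bullet> v) (at 0)"
    by (simp add: has_field_derivative_def)
  then have "((\<lambda>t. (f (a + t *\<^sub>R v) - f a) / t) \<longlongrightarrow> D \<bullet> v) (at 0)"
    by (simp add: has_field_derivative_iff)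
  then show ?thesis
    by (rule filterlim_mono) (auto simp: at_le)
qed

lemma eventually_at_right_0_unit: "\<forall>\<^sub>F t :: real in at_right 0. 0 < t \<and> t \<le> 1"
  by (auto simp: eventually_at_right_field intro!: exI[of _ 1])

lemma convex_step_in:
  fixes a b :: "'a::real_vector"
  assumes "convex S" "a \<in> S" "b \<in> S" "0 \<le> t" "t \<le> 1"
  shows "a + t *\<^sub>R (b - a) \<in> S"
  using convexD_alt[OF assms] by (simp add: algebra_simps)

text \<open>First-order optimality: on the segment from \<open>a\<close> to \<open>b\<close>, which
  lies in \<open>S\<close>, all difference quotients at the maximizer are nonpositive, and so is
  their limit.\<close>

lemma argmax_gradient_inner_nonpos:
  fixes f :: "'a::euclidean_space \<Rightarrow> real"
  assumes "convex S" "f differentiable (at a)" "a \<in> argmax_set S f" "b \<in> S"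
  shows "gradient f a \<bullet> (b - a) \<le> 0"
proof (rule tendsto_upperbound)
  show "((\<lambda>t. (f (a + t *\<^sub>R (b - a)) - f a) / t) \<longlongrightarrow> gradient f a \<bullet> (b - a)) (at_right 0)"
    by (intro GDERIV_directional_tendsto GDERIV_gradient assms)
  have a: "a \<in> S" "\<And>y. y \<in> S \<Longrightarrow> f y \<le> f a"
    using assms(3) by (auto simp: argmax_set_def is_arg_max_linorder)
  show "\<forall>\<^sub>F t in at_right 0. (f (a + t *\<^sub>R (b - a)) - f a) / t \<le> 0"
    using eventually_at_right_0_unit
  proof eventually_elim
    case (elim t)
    then show ?case
      using a(2)[OF convex_step_in[OF assms(1) a(1) assms(4), of t]]
      by (simp add: divide_le_0_iff)
  qed
qed simp

lemma strongly_concave_on_step: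
  assumes "strongly_concave_on \<mu> S f" "a \<in> S" "b \<in> S" "0 \<le> t" "t \<le> 1"
  shows "f a + t * (f b - f a) + \<mu> / 2 * t * (1 - t) * (norm (b - a))\<^sup>2 \<le> f (a + t *\<^sub>R (b - a))"
proof -
  let ?F = "\<lambda>a. f a + \<mu> / 2 * (norm a)\<^sup>2"
  have eq: "(1 - t) *\<^sub>R a + t *\<^sub>R b = a + t *\<^sub>R (b - a)"
    by (simp add: algebra_simps)
  have "concave_on S ?F"
    using assms(1) by (simp add: strongly_concave_on_def)
  then have "(1 - t) * ?F a + t * ?F b \<le> ?F ((1 - t) *\<^sub>R a + t *\<^sub>R b)"
    using assms(2-5) by (simp add: concave_on_iff)
  \<comment> \<open>The squared norm misses affine interpolation by exactly this amount, which is
    the source of the quadratic gain.\<close>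
  moreover have "(1 - t) * (norm a)\<^sup>2 + t * (norm b)\<^sup>2 - (norm (a + t *\<^sub>R (b - a)))\<^sup>2
      = t * (1 - t) * (norm (b - a))\<^sup>2"
    unfolding power2_norm_eq_inner by (simp add: algebra_simps inner_simps inner_commute)
  then have "\<mu> / 2 * ((1 - t) * (norm a)\<^sup>2 + t * (norm b)\<^sup>2 - (norm (a + t *\<^sub>R (b - a)))\<^sup>2)
      = \<mu> / 2 * (t * (1 - t) * (norm (b - a))\<^sup>2)"
    by simp
  ultimately show ?thesis
    unfolding eq by (simp add: algebra_simps add_divide_distrib diff_divide_distrib)
qed

text \<open>Divide the interpolation inequality by \<open>t\<close> and let \<open>t\<close> tend to
  0 from the right; the factor \<open>1 - t\<close> tends to 1.\<close>

lemma strongly_concave_on_gradient: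
  fixes f :: "'a::euclidean_space \<Rightarrow> real"
  assumes "strongly_concave_on \<mu> S f" "f differentiable (at a)" "a \<in> S" "b \<in> S"
  shows "f b - f a + \<mu> / 2 * (norm (b - a))\<^sup>2 \<le> gradient f a \<bullet> (b - a)"
proof (rule tendsto_le)
  show "((\<lambda>t. (f (a + t *\<^sub>R (b - a)) - f a) / t) \<longlongrightarrow> gradient f a \<bullet> (b - a)) (at_right 0)"
    by (intro GDERIV_directional_tendsto GDERIV_gradient assms)
  show "((\<lambda>t. f b - f a + \<mu> / 2 * (1 - t) * (norm (b - a))\<^sup>2)
      \<longlongrightarrow> f b - f a + \<mu> / 2 * (norm (b - a))\<^sup>2) (at_right 0)"
    by (auto intro!: tendsto_eq_intros)
  show "\<forall>\<^sub>F t in at_right 0. f b - f a + \<mu> / 2 * (1 - t) * (norm (b - a))\<^sup>2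
      \<le> (f (a + t *\<^sub>R (b - a)) - f a) / t"
    using eventually_at_right_0_unit
  proof eventually_elim
    case (elim t)
    then have "t * (f b - f a + \<mu> / 2 * (1 - t) * (norm (b - a))\<^sup>2) \<le> f (a + t *\<^sub>R (b - a)) - f a"
      using strongly_concave_on_step[OF assms(1,3,4), of t] by (simp add: algebra_simps)
    then show ?case
      using elim by (simp add: le_divide_eq mult.commute)
  qed
qed simp

text \<open>Add the gradient inequalities at \<open>a\<close> and at \<open>b\<close>: the function
  values cancel and the two halves of \<open>\<mu>\<close> combine.\<close>

lemma strongly_concave_on_gradient_monotone:
  fixes f :: "'a::euclidean_space \<Rightarrow> real"
  assumes "strongly_concave_on \<mu> S f" "f differentiable (at a)" "f differentiable (at b)"
    and "a \<in> S" "b \<in> S"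
  shows "\<mu> * (norm (b - a))\<^sup>2 \<le> (gradient f a - gradient f b) \<bullet> (b - a)"
  using strongly_concave_on_gradient[OF assms(1,2,4,5)]
    strongly_concave_on_gradient[OF assms(1,3,5,4)]
  by (simp add: norm_minus_commute inner_diff_left inner_diff_right)

lemma argmax_set_singleton:
  fixes f :: "'a::euclidean_space \<Rightarrow> real"
  assumes "S \<noteq> {}" "compact S" "convex S" "\<mu> > 0"
    and diff: "\<And>a. a \<in> S \<Longrightarrow> f differentiable (at a)"
    and conc: "strongly_concave_on \<mu> S f"
  shows "is_singleton (argmax_set S f)"
proof (rule is_singletonI')
  have "continuous_on S f"
    using diff by (meson continuous_at_imp_continuous_on differentiable_imp_continuous_within)
  then obtain a where "a \<in> S" "\<forall>y\<in>S. f y \<le> f a"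
    using continuous_attains_sup assms(1,2) by blast
  then show "argmax_set S f \<noteq> {}"
    by (auto simp: argmax_set_def is_arg_max_linorder)
next
  fix a b
  assume ab: "a \<in> argmax_set S f" "b \<in> argmax_set S f"
  then have S: "a \<in> S" "b \<in> S" and "f a = f b"
    by (auto simp: argmax_set_def is_arg_max_linorder intro: antisym)
  then have "\<mu> / 2 * (norm (b - a))\<^sup>2 \<le> 0"
    using strongly_concave_on_gradient[OF conc diff S]
      argmax_gradient_inner_nonpos[OF assms(3) diff ab(1) S(2)] by simp
  then show "a = b"
    using assms(4) by (simp add: mult_le_0_iff)
qed

text \<open>Both gradients on the right are taken at the same point \<open>b\<close>, so that a
  Lipschitz bound in the signal alone can be applied.\<close>

lemma argmax_distance_le:
  fixes f g :: "'a::euclidean_space \<Rightarrow> real"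
  assumes "convex S" "\<mu> > 0" "strongly_concave_on \<mu> S f"
    and f: "\<And>a. a \<in> S \<Longrightarrow> f differentiable (at a)"
    and g: "g differentiable (at b)"
    and a: "a \<in> argmax_set S f" and b: "b \<in> argmax_set S g"
  shows "norm (a - b) \<le> norm (gradient f b - gradient g b) / \<mu>"
proof -
  have S: "a \<in> S" "b \<in> S"
    using a b by (auto simp: argmax_set_def is_arg_max_linorder)
  have "\<mu> * (norm (b - a))\<^sup>2 \<le> (gradient f a - gradient f b) \<bullet> (b - a)"
    using strongly_concave_on_gradient_monotone assms(3) f S by blast
  \<comment> \<open>Optimality of \<open>a\<close> for \<open>f\<close> makes
    \<open>gradient f a \<bullet> (b - a)\<close> nonpositive; optimality of \<open>b\<close> for
    \<open>g\<close> makes \<open>gradient g b \<bullet> (b - a)\<close> nonnegative.\<close>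
  also have "\<dots> \<le> (gradient g b - gradient f b) \<bullet> (b - a)"
    using argmax_gradient_inner_nonpos[OF assms(1) f[OF S(1)] a S(2)]
      argmax_gradient_inner_nonpos[OF assms(1) g b S(1)]
    by (simp add: inner_diff_left inner_diff_right)
  also have "\<dots> \<le> norm (gradient g b - gradient f b) * norm (b - a)"
    by (rule norm_cauchy_schwarz)
  \<comment> \<open>One factor \<open>norm (b - a)\<close> cancels when it is nonzero; for
    \<open>b = a\<close> the bound is trivial.\<close>
  finally have "\<mu> * norm (b - a) \<le> norm (gradient g b - gradient f b)" if "b \<noteq> a"
    using that by (simp add: power2_eq_square)
  then have "\<mu> * norm (a - b) \<le> norm (gradient f b - gradient g b)"
    by (cases "b = a") (auto simp: norm_minus_commute)
  then show ?thesis
    using assms(2) by (simp add: le_divide_eq mult.commute)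
qed

theorem proposition5p2:
  fixes U :: "'x \<Rightarrow> real ^ 'm \<Rightarrow> real ^ 'd \<Rightarrow> real"
    and A :: "(real ^ 'd) set"
    and L :: "(real ^ 'm) set"
    and x :: 'x
    and \<mu> L_al :: real
  assumes "A \<noteq> {}" and "compact A" and "convex A"
    and "\<mu> > 0" and "L_al \<ge> 0"
    and "\<And>l a. l \<in> L \<Longrightarrow> a \<in> A \<Longrightarrow> U x l differentiable (at a)"
    and "\<And>l. l \<in> L \<Longrightarrow> strongly_concave_on \<mu> A (U x l)"
    and "\<And>l l' a. l \<in> L \<Longrightarrow> l' \<in> L \<Longrightarrow> a \<in> A \<Longrightarrow>
           norm (gradient (U x l) a - gradient (U x l') a) \<le> L_al * norm (l - l')"
  shows "(\<forall>l\<in>L. argmax_set A (U x l) = {best_response U A x l}) \<and>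
         (\<forall>l\<in>L. \<forall>l'\<in>L. norm (best_response U A x l - best_response U A x l')
             \<le> L_al / \<mu> * norm (l - l'))"
proof -
  have singleton: "argmax_set A (U x l) = {best_response U A x l}" if "l \<in> L" for l
    using argmax_set_singleton[OF assms(1-4), of "U x l"] assms(6,7) that
    by (auto simp: best_response_def is_singleton_the_elem)
  moreover have "norm (best_response U A x l - best_response U A x l')
      \<le> L_al / \<mu> * norm (l - l')" if "l \<in> L" "l' \<in> L" for l l'
  proof -
    let ?a = "best_response U A x l" and ?b = "best_response U A x l'"
    have ab: "?a \<in> argmax_set A (U x l)" "?b \<in> argmax_set A (U x l')"
      using singleton that by auto
    then have "?b \<in> A"
      by (auto simp: argmax_set_def is_arg_max_linorder)
    have "norm (?a - ?b) \<le> norm (gradient (U x l) ?b - gradient (U x l') ?b) / \<mu>"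
      using assms(3,4,6,7) that ab \<open>?b \<in> A\<close> by (intro argmax_distance_le) auto
    also have "\<dots> \<le> L_al * norm (l - l') / \<mu>"
      using assms(4,8) that \<open>?b \<in> A\<close> by (intro divide_right_mono) auto
    finally show ?thesis
      by simp
  qed
  ultimately show ?thesis
    by blast
qed

end
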